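(* Let $P$ be a poset with $n$ elements, and let $I$ be an order ideal of $P$. Then the collection $\mathcal{B}_{P,I}$ of $I$-sets of all linear extensions of $P$ is a shifted family of subsets of $[n]=\{1,\dots,n\}$.
   Context: An order ideal of $P$ is a subset $I\subseteq P$ such that $x<_P y$ and $y\in I$ imply $x\in I$. A linear extension of $P$ is a bijection $f:P\to[n]$ such that $i<_P j$ implies $f(i)<f(j)$. The $I$-set of a linear extension $f$ is the set $\{f(i): i\in I\}$. A family $\mathcal{B}$ of subsets of $[n]$ is shifted if for every $B\in\mathcal{B}$ and every pair $a<b$ in $[n]$ with $a\notin B$ and $b\in B$, the set $(B\setminus\{b\})\cup\{a\}$ also belongs to $\mathcal{B}$. *)

theory Defs
  imports Main
begin

text \<open>
  A poset is a carrier set \<open>A\<close> with a relation \<open>r\<close> such that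
  \<^term>\<open>partial_order_on A r\<close>; here \<open>(x, y) \<in> r\<close> is the reflexive order, so the strict
  order is \<open>(x, y) \<in> r \<and> x \<noteq> y\<close>.
\<close>

definition order_ideal :: "'a set \<Rightarrow> 'a rel \<Rightarrow> 'a set \<Rightarrow> bool" where
  "order_ideal A r I \<longleftrightarrow>
     I \<subseteq> A \<and> (\<forall>x\<in>A. \<forall>y\<in>A. (x, y) \<in> r \<and> x \<noteq> y \<and> y \<in> I \<longrightarrow> x \<in> I)"

definition linear_extension :: "'a set \<Rightarrow> 'a rel \<Rightarrow> ('a \<Rightarrow> nat) \<Rightarrow> bool" where
  "linear_extension A r f \<longleftrightarrow>
     bij_betw f A {1..card A} \<and> (\<forall>x\<in>A. \<forall>y\<in>A. (x, y) \<in> r \<and> x \<noteq> y \<longrightarrow> f x < f y)"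

text \<open>
  Values of \<open>f\<close> outside \<open>A\<close> are unconstrained, but they do not affect \<open>f ` I\<close> for \<open>I \<subseteq> A\<close>.
\<close>

definition I_sets :: "'a set \<Rightarrow> 'a rel \<Rightarrow> 'a set \<Rightarrow> nat set set" where
  "I_sets A r I = {f ` I | f. linear_extension A r f}"

definition shifted_family :: "nat \<Rightarrow> nat set set \<Rightarrow> bool" where
  "shifted_family n \<B> \<longleftrightarrow>
     \<B> \<subseteq> Pow {1..n} \<and>
     (\<forall>B\<in>\<B>. \<forall>a\<in>{1..n}. \<forall>b\<in>{1..n}.
        a < b \<and> a \<notin> B \<and> b \<in> B \<longrightarrow> (B - {b}) \<union> {a} \<in> \<B>)"

end

theory Submission
  imports Defs "HOL-Combinatorics.Transposition"
begin

text \<open>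
  It suffices to shift between neighbouring values \<open>a\<close> and \<open>a + 1\<close>. If a linear extension takes
  the value \<open>a\<close> at \<open>x \<notin> I\<close> and \<open>a + 1\<close> at \<open>y \<in> I\<close>, then \<open>x\<close> is not below \<open>y\<close> because \<open>I\<close> is an
  order ideal, so exchanging these two values gives another linear extension.
\<close>

text \<open>A long shift from \<open>b\<close> to \<open>a\<close> factors into neighbouring shifts,
  each moving an element down by one into a free place. Elements of \<open>B\<close> strictly
  between \<open>a\<close> and \<open>b\<close> obstruct a direct descent of \<open>b\<close>, so
  they pass the gap upwards instead.\<close>

lemma shifted_familyI_adjacent:
  assumes sub: "\<B> \<subseteq> Pow {1..n}"
    and adjacent: "\<And>B a. B \<in> \<B> \<Longrightarrow> a \<in> {1..n} \<Longrightarrow> Suc a \<in> {1..n} \<Longrightarrow> a \<notin> B \<Longrightarrow> Suc a \<in> B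
      \<Longrightarrow> insert a (B - {Suc a}) \<in> \<B>"
  shows "shifted_family n \<B>"
proof -
  have "insert a (B - {b}) \<in> \<B>"
    if "a < b" "B \<in> \<B>" "a \<in> {1..n}" "b \<in> {1..n}" "a \<notin> B" "b \<in> B" for a b B
    using that
  \<comment> \<open>The induction runs downwards from \<open>b - 1\<close> with \<open>b\<close>
    fixed. \<open>B\<close> must vary, since the hypothesis for \<open>Suc a\<close> may be applied
    to a set that has already been shifted.\<close>
  proof (induction a arbitrary: B rule: strict_inc_induct)
    case (base a)
    then show ?case using adjacent by simp
  next
    case (step a)
    have c: "Suc a \<in> {1..n}" "Suc a \<noteq> b" using step by auto
    show ?case
    proof (cases "Suc a \<in> B")
      case True
      \<comment> \<open>The place \<open>Suc a\<close> is occupied: its element first drops to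
        \<open>a\<close>, which frees the place for \<open>b\<close>.\<close>
      have "insert a (B - {Suc a}) \<in> \<B>"
        using adjacent step.prems c True by blast
      then have "insert (Suc a) (insert a (B - {Suc a}) - {b}) \<in> \<B>"
        using step.prems c by (intro step.IH) auto
      also have "insert (Suc a) (insert a (B - {Suc a}) - {b}) = insert a (B - {b})"
        using True step.prems c by auto
      finally show ?thesis .
    next
      case False
      \<comment> \<open>The place \<open>Suc a\<close> is free: \<open>b\<close> moves there first,
        then takes the last step to \<open>a\<close>.\<close>
      have "insert (Suc a) (B - {b}) \<in> \<B>"
        using step.prems c False by (intro step.IH) auto
      then have "insert a (insert (Suc a) (B - {b}) - {Suc a}) \<in> \<B>"
        using step.prems c by (intro adjacent) auto
      also have "insert a (insert (Suc a) (B - {b}) - {Suc a}) = insert a (B - {b})"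
        using False by auto
      finally show ?thesis .
    qed
  qed
  then show ?thesis
    using sub by (simp add: shifted_family_def)
qed

lemma transpose_image_exchange:
  assumes "a \<notin> B" "b \<in> B"
  shows "transpose a b ` B = insert a (B - {b})"
  using assms by (auto simp: transpose_def image_iff)

text \<open>No natural number lies strictly between \<open>a\<close> and \<open>Suc a\<close>, so
  exchanging them can reverse the order of that one pair only.\<close>

lemma transpose_Suc_less:
  assumes "k < l" "\<not> (k = a \<and> l = Suc a)"
  shows "transpose a (Suc a) k < transpose a (Suc a) l"
  using assms by (auto simp: transpose_def)

text \<open>One direction suffices in \<open>incomparable\<close>: \<open>(y, x) \<in> r\<close>
  would already force \<open>f y < f x\<close>, contrary to the two values.\<close>

lemma linear_extension_transpose:
  assumes f: "linear_extension A r f"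
    and a: "a \<in> {1..card A}" "Suc a \<in> {1..card A}"
    and incomparable: "\<And>x y. x \<in> A \<Longrightarrow> y \<in> A \<Longrightarrow> f x = a \<Longrightarrow> f y = Suc a \<Longrightarrow> (x, y) \<notin> r"
  shows "linear_extension A r (transpose a (Suc a) \<circ> f)"
  unfolding linear_extension_def
proof (intro conjI ballI impI)
  have "bij_betw (transpose a (Suc a)) {1..card A} {1..card A}"
    using a by (simp add: bij_betw_def)
  then show "bij_betw (transpose a (Suc a) \<circ> f) A {1..card A}"
    using f bij_betw_trans unfolding linear_extension_def by blast
next
  fix x y
  assume xy: "x \<in> A" "y \<in> A" "(x, y) \<in> r \<and> x \<noteq> y"
  then have "f x < f y" "\<not> (f x = a \<and> f y = Suc a)"
    using f incomparable unfolding linear_extension_def by blast+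
  then show "(transpose a (Suc a) \<circ> f) x < (transpose a (Suc a) \<circ> f) y"
    by (simp add: transpose_Suc_less)
qed

theorem proposition4p6:
  fixes A :: "'a set" and r :: "'a rel" and I :: "'a set" and n :: nat
  assumes "finite A"
    and "card A = n"
    and "partial_order_on A r"
    and "order_ideal A r I"
  shows "shifted_family n (I_sets A r I)"
proof (rule shifted_familyI_adjacent)
  have "I \<subseteq> A" using assms(4) by (simp add: order_ideal_def)
  then have "f ` I \<subseteq> {1..n}" if "linear_extension A r f" for f
    using that assms(2) unfolding linear_extension_def bij_betw_def by blast
  then show "I_sets A r I \<subseteq> Pow {1..n}"
    unfolding I_sets_def by blast
next
  fix B a
  assume B: "B \<in> I_sets A r I" and a: "a \<in> {1..n}" "Suc a \<in> {1..n}" "a \<notin> B" "Suc a \<in> B"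
  obtain f where f: "linear_extension A r f" "B = f ` I"
    using B by (auto simp: I_sets_def)
  have inj: "inj_on f A" and I: "I \<subseteq> A"
    using f(1) assms(4) by (auto simp: linear_extension_def order_ideal_def bij_betw_def)
  have "(x, y) \<notin> r" if xy: "x \<in> A" "y \<in> A" "f x = a" "f y = Suc a" for x y
  proof -
    \<comment> \<open>Some element of \<open>I\<close> has the value \<open>Suc a\<close>;
      injectivity of \<open>f\<close> on \<open>A\<close> identifies it with
      \<open>y\<close>.\<close>
    have "x \<notin> I" "y \<in> I"
      using a(3,4) xy inj_on_image_mem_iff [OF inj _ I] unfolding f(2) by metis+
    then show ?thesis
      using assms(4) xy(1,2) by (auto simp: order_ideal_def)
  qed
  then have "linear_extension A r (transpose a (Suc a) \<circ> f)"
    using f(1) a assms(2) by (intro linear_extension_transpose) auto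
  moreover have "(transpose a (Suc a) \<circ> f) ` I = insert a (B - {Suc a})"
    using transpose_image_exchange [OF a(3,4)] f(2) by (simp add: image_comp)
  ultimately show "insert a (B - {Suc a}) \<in> I_sets A r I"
    unfolding I_sets_def by blast
qed

end
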